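(* Let $\mathcal C\subseteq 2^{[n]}$ be a simplicial complex. Then $\operatorname{cdim}(\mathcal C)=\operatorname{odim}(\mathcal C)$.
   Context: A (combinatorial) code is a set $\mathcal C\subseteq 2^{[n]}$ of subsets of $[n]=\{1,\dots,n\}$ (codewords); by convention every code contains $\emptyset$. For a collection $\mathcal U=\{U_1,\dots,U_n\}$ of subsets of $\mathbb R^d$, write $U_\sigma=\bigcap_{i\in\sigma}U_i$ (with $U_\emptyset=\mathbb R^d$) and define $\operatorname{code}(\mathcal U)=\{\sigma\subseteq[n] : U_\sigma\setminus\bigcup_{j\notin\sigma}U_j\neq\emptyset\}$; $\mathcal U$ is a realization of $\mathcal C$ if $\operatorname{code}(\mathcal U)=\mathcal C$. $\operatorname{odim}(\mathcal C)$ (resp. $\operatorname{cdim}(\mathcal C)$) is the smallest $d$ such that $\mathcal C$ has a realization in $\mathbb R^d$ by (possibly empty) convex open (resp. convex closed) sets, or $\infty$ if none exists. A simplicial complex is a code closed under taking subsets. *)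

theory Defs
  imports "HOL-Analysis.Analysis" "HOL-Library.Extended_Nat"
begin

text \<open>The ground set $[n]$ is \<open>{1..n}\<close>; by convention every code contains the empty codeword.\<close>

definition is_code :: "nat \<Rightarrow> nat set set \<Rightarrow> bool" where
  "is_code n C \<longleftrightarrow> C \<subseteq> Pow {1..n} \<and> {} \<in> C"

definition is_simplicial_complex :: "nat \<Rightarrow> nat set set \<Rightarrow> bool" where
  "is_simplicial_complex n C \<longleftrightarrow> is_code n C \<and> (\<forall>\<sigma>\<in>C. \<forall>\<tau>. \<tau> \<subseteq> \<sigma> \<longrightarrow> \<tau> \<in> C)"

text \<open>
  Since the dimension \<open>d\<close> is minimised over, $\mathbb R^d$ cannot be a type here. It is the
  library's topological space \<^const>\<open>Euclidean_space\<close> \<open>d\<close>, whose points are the functions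
  \<open>x :: nat \<Rightarrow> real\<close> with \<open>x i = 0\<close> for \<open>i \<ge> d\<close>; for \<open>d = 0\<close> it is a single point.
  As the type \<^typ>\<open>nat \<Rightarrow> real\<close> has no \<^class>\<open>real_vector\<close> instance, \<^const>\<open>convex\<close> is
  not available and convexity is spelled out coordinatewise.
\<close>

definition convex_fun :: "(nat \<Rightarrow> real) set \<Rightarrow> bool" where
  "convex_fun S \<longleftrightarrow> (\<forall>x\<in>S. \<forall>y\<in>S. \<forall>u\<ge>0. \<forall>v\<ge>0. u + v = 1 \<longrightarrow> (\<lambda>i. u * x i + v * y i) \<in> S)"

text \<open>Intersecting with the whole space gives $U_\emptyset = \mathbb R^d$.\<close>

definition Inter_at :: "nat \<Rightarrow> (nat \<Rightarrow> (nat \<Rightarrow> real) set) \<Rightarrow> nat set \<Rightarrow> (nat \<Rightarrow> real) set" where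
  "Inter_at d U \<sigma> = topspace (Euclidean_space d) \<inter> (\<Inter>i\<in>\<sigma>. U i)"

definition code_of :: "nat \<Rightarrow> nat \<Rightarrow> (nat \<Rightarrow> (nat \<Rightarrow> real) set) \<Rightarrow> nat set set" where
  "code_of d n U = {\<sigma>. \<sigma> \<subseteq> {1..n} \<and> Inter_at d U \<sigma> - (\<Union>j\<in>{1..n} - \<sigma>. U j) \<noteq> {}}"

definition open_convex_realization ::
    "nat \<Rightarrow> nat \<Rightarrow> nat set set \<Rightarrow> (nat \<Rightarrow> (nat \<Rightarrow> real) set) \<Rightarrow> bool" where
  "open_convex_realization d n C U \<longleftrightarrow>
     (\<forall>i\<in>{1..n}. openin (Euclidean_space d) (U i) \<and> convex_fun (U i)) \<and> code_of d n U = C"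

definition closed_convex_realization ::
    "nat \<Rightarrow> nat \<Rightarrow> nat set set \<Rightarrow> (nat \<Rightarrow> (nat \<Rightarrow> real) set) \<Rightarrow> bool" where
  "closed_convex_realization d n C U \<longleftrightarrow>
     (\<forall>i\<in>{1..n}. closedin (Euclidean_space d) (U i) \<and> convex_fun (U i)) \<and> code_of d n U = C"

text \<open>In \<^typ>\<open>enat\<close> the infimum of a nonempty set is its least element, and \<open>Inf {} = \<infinity>\<close>.\<close>

definition odim :: "nat \<Rightarrow> nat set set \<Rightarrow> enat" where
  "odim n C = Inf {enat d | d. \<exists>U. open_convex_realization d n C U}"

definition cdim :: "nat \<Rightarrow> nat set set \<Rightarrow> enat" where
  "cdim n C = Inf {enat d | d. \<exists>U. closed_convex_realization d n C U}"

end

theory Submission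
  imports Defs
begin

text \<open>
  For a simplicial complex only two things matter: every codeword \<open>\<sigma>\<close> has a witness point \<open>p \<sigma>\<close>
  lying in exactly the sets indexed by \<open>\<sigma>\<close>, and no point lies in a family of sets outside \<open>C\<close>.
  Given open convex sets, erode each by a small \<open>\<epsilon>\<close>: the erosions are closed and convex, still
  contain the finitely many witnesses, and being smaller create no new intersections. Given closed
  convex sets, cut them to a large box containing the witnesses and thicken each by a small \<open>\<epsilon>\<close>: the
  witnesses stay outside the sets they avoid, and by compactness empty intersections stay empty.
  Hence the realizable dimensions are the same in both senses.
\<close>

section \<open>Open sup-norm balls, Minkowski thickening and erosion\<close>

definition cube :: "nat \<Rightarrow> (nat \<Rightarrow> real) \<Rightarrow> real \<Rightarrow> (nat \<Rightarrow> real) set" where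
  "cube d x e = {y \<in> topspace (Euclidean_space d). \<forall>k<d. \<bar>y k - x k\<bar> < e}"

definition thicken :: "nat \<Rightarrow> real \<Rightarrow> (nat \<Rightarrow> real) set \<Rightarrow> (nat \<Rightarrow> real) set" where
  "thicken d e S = (\<Union>x\<in>S. cube d x e)"

text \<open>Written as the complement of a thickened complement, so that closedness follows from
  openness of thickenings; \<open>mem_erode_iff\<close> recovers the usual form.\<close>

definition erode :: "nat \<Rightarrow> real \<Rightarrow> (nat \<Rightarrow> real) set \<Rightarrow> (nat \<Rightarrow> real) set" where
  "erode d e S = topspace (Euclidean_space d) - thicken d e (topspace (Euclidean_space d) - S)"

lemma mem_cube_iff:
  "y \<in> cube d x e \<longleftrightarrow> y \<in> topspace (Euclidean_space d) \<and> (\<forall>k<d. \<bar>y k - x k\<bar> < e)"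
  by (simp add: cube_def)

lemma cube_sym:
  assumes "x \<in> topspace (Euclidean_space d)" "y \<in> cube d x e"
  shows "x \<in> cube d y e"
  using assms by (auto simp: mem_cube_iff abs_minus_commute)

lemma centre_in_cube: "x \<in> topspace (Euclidean_space d) \<Longrightarrow> 0 < e \<Longrightarrow> x \<in> cube d x e"
  by (simp add: mem_cube_iff)

lemma cube_triangle:
  assumes "y \<in> cube d x e" "z \<in> cube d y f"
  shows "z \<in> cube d x (e + f)"
  unfolding mem_cube_iff
proof (intro conjI allI impI)
  show "z \<in> topspace (Euclidean_space d)" using assms by (simp add: mem_cube_iff)
  fix k assume "k < d"
  then have "\<bar>y k - x k\<bar> < e" "\<bar>z k - y k\<bar> < f" using assms by (auto simp: mem_cube_iff)
  then show "\<bar>z k - x k\<bar> < e + f" by linarith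
qed

lemma cube_mono: "e \<le> f \<Longrightarrow> cube d x e \<subseteq> cube d x f"
  by (force simp: cube_def)

lemma openin_cube: "openin (Euclidean_space d) (cube d x e)"
proof -
  let ?E = "Euclidean_space d"
  have "openin ?E {y \<in> topspace ?E. y k \<in> {x k - e<..<x k + e}}" for k
  proof (rule openin_continuous_map_preimage)
    show "continuous_map ?E euclideanreal (\<lambda>y. y k)"
      unfolding Euclidean_space_def
      by (intro continuous_map_from_subtopology continuous_map_product_projection) simp
  qed auto
  \<comment> \<open>For \<open>d = 0\<close> the indexed intersection is \<open>UNIV\<close>, so the
    whole space is intersected in explicitly.\<close>
  then have "openin ?E (topspace ?E \<inter> (\<Inter>k\<in>{..<d}. {y \<in> topspace ?E. y k \<in> {x k - e<..<x k + e}}))"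
    by (cases "d = 0") auto
  also have "topspace ?E \<inter> (\<Inter>k\<in>{..<d}. {y \<in> topspace ?E. y k \<in> {x k - e<..<x k + e}}) = cube d x e"
  proof -
    have "y k \<in> {x k - e<..<x k + e} \<longleftrightarrow> \<bar>y k - x k\<bar> < e" for y k by auto
    then show ?thesis unfolding cube_def by blast
  qed
  finally show ?thesis .
qed

text \<open>A basic product neighbourhood may restrict any coordinate, but those from
  \<open>d\<close> on vanish throughout the space. Only the first \<open>d\<close> coordinates
  constrain the radius.\<close>

lemma cube_in_open:
  assumes "openin (Euclidean_space d) U" "x \<in> U"
  shows "\<exists>e>0. cube d x e \<subseteq> U"
proof -
  obtain W where W: "openin (powertop_real UNIV) W" and U: "U = W \<inter> {y. \<forall>i\<ge>d. y i = 0}"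
    using assms(1) unfolding Euclidean_space_def openin_subtopology by blast
  obtain B where B: "\<And>i. open (B i)" "x \<in> PiE UNIV B" "PiE UNIV B \<subseteq> W"
  proof -
    have "x \<in> W" using assms(2) U by simp
    from bspec[OF W[unfolded openin_product_topology_alt] this]
    obtain B where "\<forall>i\<in>UNIV. openin euclideanreal (B i)" "x \<in> PiE UNIV B" "PiE UNIV B \<subseteq> W"
      by (elim exE conjE) (rule that)
    then show ?thesis by (intro that[of B]) simp_all
  qed
  \<comment> \<open>The filter \<open>at_right 0\<close> expresses "for all sufficiently small
    positive \<open>e\<close>". Finitely many such conditions combine without taking a minimum of
    radii.\<close>
  have "\<forall>\<^sub>F e in at_right 0. \<forall>t. \<bar>t - x k\<bar> < e \<longrightarrow> t \<in> B k" for k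
  proof -
    obtain e where "0 < e" "\<And>t. \<bar>t - x k\<bar> < e \<Longrightarrow> t \<in> B k"
      using bspec[OF B(1)[of k, unfolded open_dist dist_real_def] PiE_mem[OF B(2) UNIV_I]] by blast
    then show ?thesis by (intro eventually_at_rightI[of 0 e]) auto
  qed
  then have "\<forall>\<^sub>F e in at_right 0. \<forall>k\<in>{..<d}. \<forall>t. \<bar>t - x k\<bar> < e \<longrightarrow> t \<in> B k"
    by (intro eventually_ball_finite) auto
  then have "\<forall>\<^sub>F e in at_right 0. e > 0 \<and> (\<forall>k\<in>{..<d}. \<forall>t. \<bar>t - x k\<bar> < e \<longrightarrow> t \<in> B k)"
    by (intro eventually_conj eventually_at_right_less)
  then obtain e where e: "e > 0" "\<And>k t. k < d \<Longrightarrow> \<bar>t - x k\<bar> < e \<Longrightarrow> t \<in> B k"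
    using eventually_happens'[OF trivial_limit_at_right_real] by (metis (no_types, lifting) lessThan_iff)
  have "y \<in> U" if "y \<in> cube d x e" for y
  proof -
    have y: "\<forall>i\<ge>d. y i = 0" "\<And>k. k < d \<Longrightarrow> \<bar>y k - x k\<bar> < e"
      using that by (auto simp: mem_cube_iff topspace_Euclidean_space)
    have "y k \<in> B k" for k
    proof (cases "k < d")
      case True
      then show ?thesis using y e by blast
    next
      case False
      then have "y k = x k" using y(1) assms(2) U by simp
      then show ?thesis using B(2) by auto
    qed
    then show ?thesis using y(1) B(3) U by auto
  qed
  then show ?thesis using e(1) by blast
qed

lemma eventually_cube_subset:
  assumes "openin (Euclidean_space d) U" "x \<in> U"
  shows "\<forall>\<^sub>F e in at_right 0. cube d x e \<subseteq> U"
proof -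
  obtain e where e: "0 < e" "cube d x e \<subseteq> U" using cube_in_open[OF assms] by blast
  show ?thesis
  proof (rule eventually_at_rightI[of 0 e])
    fix e' assume "e' \<in> {0<..<e}"
    then have "cube d x e' \<subseteq> cube d x e" by (intro cube_mono) simp
    then show "cube d x e' \<subseteq> U" using e(2) by (rule subset_trans)
  qed (rule e(1))
qed

lemma openin_thicken: "openin (Euclidean_space d) (thicken d e S)"
  unfolding thicken_def by (intro openin_Union) (auto intro: openin_cube)

lemma closedin_erode: "closedin (Euclidean_space d) (erode d e S)"
  unfolding erode_def by (intro closedin_diff openin_thicken) auto

lemma subset_thicken:
  "S \<subseteq> topspace (Euclidean_space d) \<Longrightarrow> 0 < e \<Longrightarrow> S \<subseteq> thicken d e S"
  unfolding thicken_def using centre_in_cube by fastforce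

lemma mem_thicken_iff:
  assumes "S \<subseteq> topspace (Euclidean_space d)" "x \<in> topspace (Euclidean_space d)"
  shows "x \<in> thicken d e S \<longleftrightarrow> cube d x e \<inter> S \<noteq> {}"
  using assms cube_sym unfolding thicken_def by fastforce

text \<open>By symmetry of cubes, \<open>x\<close> lies in the thickened complement of
  \<open>S\<close> exactly when the cube around \<open>x\<close> meets that complement.\<close>

lemma mem_erode_iff:
  "x \<in> erode d e S \<longleftrightarrow> x \<in> topspace (Euclidean_space d) \<and> cube d x e \<subseteq> S"
proof -
  have "cube d x e \<subseteq> topspace (Euclidean_space d)" by (auto simp: mem_cube_iff)
  then show ?thesis
    using mem_thicken_iff[of "topspace (Euclidean_space d) - S" d x e]
    unfolding erode_def by blast
qed

lemma erode_subset: "0 < e \<Longrightarrow> erode d e S \<subseteq> S"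
  using centre_in_cube by (fastforce simp: mem_erode_iff)

section \<open>Convexity of thickenings and erosions\<close>

lemma convex_funD:
  "convex_fun S \<Longrightarrow> x \<in> S \<Longrightarrow> y \<in> S \<Longrightarrow> 0 \<le> u \<Longrightarrow> 0 \<le> v \<Longrightarrow> u + v = 1
    \<Longrightarrow> (\<lambda>i. u * x i + v * y i) \<in> S"
  by (simp add: convex_fun_def)

lemma convex_fun_Int: "convex_fun S \<Longrightarrow> convex_fun T \<Longrightarrow> convex_fun (S \<inter> T)"
  by (simp add: convex_fun_def)

lemma abs_convex_comb_less:
  fixes a b :: real
  assumes "0 \<le> u" "0 \<le> v" "u + v = 1" "\<bar>a\<bar> < e" "\<bar>b\<bar> < e"
  shows "\<bar>u * a + v * b\<bar> < e"
  using convex_bound_lt[of a e b u v] convex_bound_lt[of "-a" e "-b" u v] assms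
  by (auto simp: abs_less_iff)

text \<open>The displacement of a combination of points from the same combination of centres is the
  combined displacement, so it stays below \<open>e\<close> in each coordinate.\<close>

lemma convex_fun_thicken:
  assumes "convex_fun S"
  shows "convex_fun (thicken d e S)"
  unfolding convex_fun_def
proof (intro ballI allI impI)
  fix x x' :: "nat \<Rightarrow> real" and u v :: real
  assume "x \<in> thicken d e S" "x' \<in> thicken d e S" and uv: "0 \<le> u" "0 \<le> v" "u + v = 1"
  then obtain y y' where y: "y \<in> S" "x \<in> cube d y e" "y' \<in> S" "x' \<in> cube d y' e"
    by (auto simp: thicken_def)
  have "(\<lambda>i. u * x i + v * x' i) \<in> cube d (\<lambda>i. u * y i + v * y' i) e"
    unfolding mem_cube_iff
  proof (intro conjI allI impI)
    show "(\<lambda>i. u * x i + v * x' i) \<in> topspace (Euclidean_space d)"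
      using y by (simp add: mem_cube_iff topspace_Euclidean_space)
    fix k assume "k < d"
    then have "\<bar>u * (x k - y k) + v * (x' k - y' k)\<bar> < e"
      using y uv by (intro abs_convex_comb_less) (auto simp: mem_cube_iff)
    then show "\<bar>u * x k + v * x' k - (u * y k + v * y' k)\<bar> < e"
      by (simp add: algebra_simps)
  qed
  moreover have "(\<lambda>i. u * y i + v * y' i) \<in> S"
    using y uv by (intro convex_funD[OF assms])
  ultimately show "(\<lambda>i. u * x i + v * x' i) \<in> thicken d e S"
    unfolding thicken_def by blast
qed

text \<open>A point \<open>w\<close> of the cube around the combination \<open>?z\<close> is the
  same combination of the translates of \<open>x\<close> and \<open>x'\<close> by
  \<open>w - ?z\<close>, and both translates lie in \<open>S\<close>.\<close>

lemma convex_fun_erode: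
  assumes "convex_fun S"
  shows "convex_fun (erode d e S)"
  unfolding convex_fun_def
proof (intro ballI allI impI)
  fix x x' :: "nat \<Rightarrow> real" and u v :: real
  assume x: "x \<in> erode d e S" "x' \<in> erode d e S" and uv: "0 \<le> u" "0 \<le> v" "u + v = 1"
  let ?z = "\<lambda>i. u * x i + v * x' i"
  have zero: "\<forall>i\<ge>d. x i = 0" "\<forall>i\<ge>d. x' i = 0"
    using x by (auto simp: mem_erode_iff topspace_Euclidean_space)
  have "w \<in> S" if w: "w \<in> cube d ?z e" for w
  proof -
    \<comment> \<open>The displacement vanishes from coordinate \<open>d\<close> on, so both
      translates remain in the space.\<close>
    let ?y = "\<lambda>i. x i + (w i - ?z i)" and ?y' = "\<lambda>i. x' i + (w i - ?z i)"
    have "?y \<in> cube d x e" "?y' \<in> cube d x' e"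
      using w zero by (auto simp: mem_cube_iff topspace_Euclidean_space)
    then have "?y \<in> S" "?y' \<in> S" using x by (auto simp: mem_erode_iff)
    then have "(\<lambda>i. u * ?y i + v * ?y' i) \<in> S"
      using uv by (intro convex_funD[OF assms])
    also have "(\<lambda>i. u * ?y i + v * ?y' i) = w"
    proof
      fix i
      have "u * (a + c) + v * (b + c) = u * a + v * b + (u + v) * c" for a b c
        by (simp add: algebra_simps)
      from this[of "x i" "w i - ?z i" "x' i"] show "u * ?y i + v * ?y' i = w i"
        using uv(3) by simp
    qed
    finally show ?thesis .
  qed
  then show "?z \<in> erode d e S"
    using zero by (auto simp: mem_erode_iff topspace_Euclidean_space)
qed

section \<open>Compact boxes and disjointness under small thickening\<close>

definition closed_box :: "nat \<Rightarrow> real \<Rightarrow> (nat \<Rightarrow> real) set" where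
  "closed_box d R = PiE UNIV (\<lambda>k. if k < d then {-R..R} else {0})"

lemma mem_closed_box_iff:
  "x \<in> closed_box d R \<longleftrightarrow> x \<in> topspace (Euclidean_space d) \<and> (\<forall>k<d. \<bar>x k\<bar> \<le> R)"
proof -
  have "x \<in> closed_box d R \<longleftrightarrow> (\<forall>k. x k \<in> (if k < d then {-R..R} else {0}))"
    by (simp add: closed_box_def PiE_iff)
  also have "\<dots> \<longleftrightarrow> (\<forall>k. (k < d \<longrightarrow> \<bar>x k\<bar> \<le> R) \<and> (k \<ge> d \<longrightarrow> x k = 0))"
    by (intro all_cong1) (auto simp: abs_le_iff)
  also have "\<dots> \<longleftrightarrow> x \<in> topspace (Euclidean_space d) \<and> (\<forall>k<d. \<bar>x k\<bar> \<le> R)"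
    by (auto simp: topspace_Euclidean_space)
  finally show ?thesis .
qed

text \<open>Tychonoff's theorem applies directly because the box is a full product, with the factor
  \<open>{0}\<close> in every coordinate from \<open>d\<close> on.\<close>

lemma compactin_closed_box: "compactin (Euclidean_space d) (closed_box d R)"
proof -
  have "compactin (powertop_real UNIV) (closed_box d R)"
    unfolding closed_box_def by (subst compactin_PiE) auto
  then show ?thesis
    using mem_closed_box_iff[of _ d R]
    by (auto simp: Euclidean_space_def compactin_subtopology)
qed

lemma convex_fun_closed_box: "convex_fun (closed_box d R)"
  unfolding convex_fun_def
proof (intro ballI allI impI)
  fix x y :: "nat \<Rightarrow> real" and u v :: real
  assume x: "x \<in> closed_box d R" "y \<in> closed_box d R" and uv: "0 \<le> u" "0 \<le> v" "u + v = 1"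
  have "\<bar>u * x k + v * y k\<bar> \<le> R" if "k < d" for k
    using convex_bound_le[of "x k" R "y k" u v] convex_bound_le[of "- x k" R "- y k" u v] x uv that
    by (auto simp: mem_closed_box_iff abs_le_iff)
  then show "(\<lambda>i. u * x i + v * y i) \<in> closed_box d R"
    using x by (simp add: mem_closed_box_iff topspace_Euclidean_space)
qed

lemma finite_subset_closed_box:
  assumes "finite P" "P \<subseteq> topspace (Euclidean_space d)"
  obtains R where "P \<subseteq> closed_box d R"
proof
  \<comment> \<open>A double sum dominates every coordinate and, unlike a maximum, is also defined
    when \<open>P\<close> is empty or \<open>d = 0\<close>.\<close>
  let ?R = "\<Sum>x\<in>P. \<Sum>k<d. \<bar>x k\<bar>"
  have "\<bar>x k\<bar> \<le> ?R" if "x \<in> P" "k < d" for x k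
  proof -
    have "\<bar>x k\<bar> \<le> (\<Sum>k<d. \<bar>x k\<bar>)" using that by (intro member_le_sum) auto
    also have "\<dots> \<le> ?R"
      using that assms(1) by (intro member_le_sum[of x P "\<lambda>x. \<Sum>k<d. \<bar>x k\<bar>"]) (auto intro: sum_nonneg)
    finally show ?thesis .
  qed
  then show "P \<subseteq> closed_box d ?R" using assms(2) by (auto simp: mem_closed_box_iff)
qed

text \<open>A Lebesgue number argument: each point of \<open>K\<close> has a cube missing some
  \<open>A i\<close>, finitely many smaller cubes cover \<open>K\<close>, and any \<open>e\<close>
  below all their radii works.\<close>

lemma eventually_thicken_disjoint:
  assumes K: "compactin (Euclidean_space d) K" and "I \<noteq> {}"
    and A: "\<And>i. i \<in> I \<Longrightarrow> closedin (Euclidean_space d) (A i)" "\<And>i. i \<in> I \<Longrightarrow> A i \<subseteq> K"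
    and empty: "(\<Inter>i\<in>I. A i) = {}"
  shows "\<forall>\<^sub>F e in at_right 0. (\<Inter>i\<in>I. thicken d e (A i)) = {}"
proof -
  let ?E = "Euclidean_space d"
  have KE: "K \<subseteq> topspace ?E" using K by (simp add: compactin_subspace)
  \<comment> \<open>The factor 3 leaves room for three moves of size at most \<open>r\<close>: from
    \<open>x\<close> to \<open>y\<close> in \<open>K\<close>, on to the common point
    \<open>z\<close>, and back to \<open>w\<close> in \<open>A i\<close>.\<close>
  have "\<exists>r>0. \<exists>i\<in>I. cube d x (3 * r) \<inter> A i = {}" if x: "x \<in> K" for x
  proof -
    obtain i where i: "i \<in> I" "x \<notin> A i" using empty by blast
    then obtain e where "e > 0" "cube d x e \<subseteq> topspace ?E - A i"
      using cube_in_open[of d "topspace ?E - A i" x] A(1) x KE by auto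
    then show ?thesis using i by (intro exI[of _ "e / 3"]) auto
  qed
  then obtain r where r: "\<And>x. x \<in> K \<Longrightarrow> r x > 0"
    "\<And>x. x \<in> K \<Longrightarrow> \<exists>i\<in>I. cube d x (3 * r x) \<inter> A i = {}" by metis
  have "\<exists>F. finite F \<and> F \<subseteq> (\<lambda>x. cube d x (r x)) ` K \<and> K \<subseteq> \<Union>F"
  proof (rule compactinD[OF K])
    show "K \<subseteq> \<Union> ((\<lambda>x. cube d x (r x)) ` K)"
      using r(1) KE centre_in_cube by blast
  qed (auto intro: openin_cube)
  then obtain F where F: "finite F" "F \<subseteq> (\<lambda>x. cube d x (r x)) ` K" "K \<subseteq> \<Union>F" by blast
  \<comment> \<open>Indexing the subcover by its centres gives access to the finitely many radii
    \<open>r x\<close>.\<close>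
  obtain X where X: "finite X" "X \<subseteq> K" "K \<subseteq> (\<Union>x\<in>X. cube d x (r x))"
    using finite_subset_image[OF F(1,2)] F(3) by blast
  have "\<forall>\<^sub>F e in at_right 0. \<forall>x\<in>X. e < r x"
    using X r(1) by (intro eventually_ball_finite ballI) (auto simp: eventually_at_right_field)
  then show ?thesis
  proof eventually_elim
    case (elim e)
    show ?case
    proof (rule ccontr)
      assume "\<not> ?thesis"
      then obtain z where z: "\<And>i. i \<in> I \<Longrightarrow> z \<in> thicken d e (A i)" by blast
      \<comment> \<open>The common point \<open>z\<close> may lie outside \<open>K\<close>, where
        the cover says nothing; a nearby point \<open>y\<close> of some \<open>A j\<close> is used
        instead.\<close>
      obtain j where "j \<in> I" using \<open>I \<noteq> {}\<close> by blast
      then obtain y where y: "y \<in> K" "z \<in> cube d y e"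
        using z A(2) unfolding thicken_def by blast
      then obtain x where x: "x \<in> X" "y \<in> cube d x (r x)" using X(3) by blast
      then obtain i where i: "i \<in> I" "cube d x (3 * r x) \<inter> A i = {}" using r(2) X(2) by blast
      obtain w where w: "w \<in> A i" "z \<in> cube d w e"
        using z[OF i(1)] by (auto simp: thicken_def)
      have "w \<in> cube d z e"
        using w(1) A(2)[OF i(1)] KE by (intro cube_sym[OF _ w(2)]) blast
      then have "w \<in> cube d x (r x + e + e)"
        by (intro cube_triangle[OF cube_triangle[OF x(2) y(2)]])
      moreover have "r x + e + e \<le> 3 * r x" using elim x(1) by fastforce
      ultimately have "w \<in> cube d x (3 * r x)" using cube_mono by blast
      then show False using w(1) i(2) by blast
    qed
  qed
qed

section \<open>Codes through witness points\<close>

lemma mem_code_of_iff: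
  "\<sigma> \<in> code_of d n U \<longleftrightarrow>
     \<sigma> \<subseteq> {1..n} \<and> (\<exists>x\<in>topspace (Euclidean_space d). \<forall>i\<in>{1..n}. x \<in> U i \<longleftrightarrow> i \<in> \<sigma>)"
  unfolding code_of_def Inter_at_def by (auto; blast)

text \<open>A point witnesses only its own membership pattern, so the code is the set of all
  patterns that occur.\<close>

lemma code_of_eqI:
  assumes "C \<subseteq> Pow {1..n}"
    and "\<And>\<sigma>. \<sigma> \<in> C \<Longrightarrow> \<exists>x\<in>topspace (Euclidean_space d). \<forall>i\<in>{1..n}. x \<in> U i \<longleftrightarrow> i \<in> \<sigma>"
    and "\<And>x. x \<in> topspace (Euclidean_space d) \<Longrightarrow> {i\<in>{1..n}. x \<in> U i} \<in> C"
  shows "code_of d n U = C"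
proof (intro equalityI subsetI)
  fix \<sigma> assume "\<sigma> \<in> code_of d n U"
  then obtain x where x: "\<sigma> \<subseteq> {1..n}" "x \<in> topspace (Euclidean_space d)"
    "\<forall>i\<in>{1..n}. x \<in> U i \<longleftrightarrow> i \<in> \<sigma>" by (auto simp: mem_code_of_iff)
  then have "{i\<in>{1..n}. x \<in> U i} = \<sigma>" by blast
  then show "\<sigma> \<in> C" using assms(3)[OF x(2)] by simp
next
  fix \<sigma> assume "\<sigma> \<in> C"
  then show "\<sigma> \<in> code_of d n U" using assms(1,2) unfolding mem_code_of_iff by blast
qed

lemma code_of_witnesses:
  obtains p where
    "\<And>\<sigma>. \<sigma> \<in> code_of d n U \<Longrightarrow> p \<sigma> \<in> topspace (Euclidean_space d)"
    "\<And>\<sigma> i. \<sigma> \<in> code_of d n U \<Longrightarrow> i \<in> {1..n} \<Longrightarrow> p \<sigma> \<in> U i \<longleftrightarrow> i \<in> \<sigma>"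
proof -
  have "\<forall>\<sigma>\<in>code_of d n U. \<exists>x. x \<in> topspace (Euclidean_space d) \<and> (\<forall>i\<in>{1..n}. x \<in> U i \<longleftrightarrow> i \<in> \<sigma>)"
    by (auto simp: mem_code_of_iff)
  from bchoice[OF this] show ?thesis using that by blast
qed

lemma simplicial_complexD:
  assumes "is_simplicial_complex n C"
  shows "C \<subseteq> Pow {1..n}" "{} \<in> C" "finite C" "\<And>\<sigma> \<tau>. \<sigma> \<in> C \<Longrightarrow> \<tau> \<subseteq> \<sigma> \<Longrightarrow> \<tau> \<in> C"
  using assms finite_subset[of C "Pow {1..n}"]
  by (auto simp: is_simplicial_complex_def is_code_def)

text \<open>Closure under subsets enters here: \<open>x\<close> may lie in further sets, so its full
  pattern is a codeword containing \<open>\<tau>\<close>, and \<open>\<tau>\<close> is a codeword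
  with it.\<close>

lemma subset_pattern_in_complex:
  assumes "is_simplicial_complex n C" "code_of d n U = C"
    and "x \<in> topspace (Euclidean_space d)" "\<tau> \<subseteq> {1..n}" "\<And>i. i \<in> \<tau> \<Longrightarrow> x \<in> U i"
  shows "\<tau> \<in> C"
proof -
  have "{i\<in>{1..n}. x \<in> U i} \<in> C"
    unfolding assms(2)[symmetric] mem_code_of_iff using assms(3) by (auto intro!: bexI[of _ x])
  moreover have "\<tau> \<subseteq> {i\<in>{1..n}. x \<in> U i}" using assms(4,5) by blast
  ultimately show ?thesis by (rule simplicial_complexD(4)[OF assms(1)])
qed

section \<open>Passing between open and closed realizations\<close>

lemma closed_realization_of_open:
  assumes C: "is_simplicial_complex n C" and U: "open_convex_realization d n C U"
  shows "\<exists>V. closed_convex_realization d n C V"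
proof -
  have opn: "openin (Euclidean_space d) (U i)" "convex_fun (U i)" if "i \<in> {1..n}" for i
    using U that by (auto simp: open_convex_realization_def)
  have code: "code_of d n U = C" using U by (simp add: open_convex_realization_def)
  obtain p where p: "\<And>\<sigma>. \<sigma> \<in> C \<Longrightarrow> p \<sigma> \<in> topspace (Euclidean_space d)"
    "\<And>\<sigma> i. \<sigma> \<in> C \<Longrightarrow> i \<in> {1..n} \<Longrightarrow> p \<sigma> \<in> U i \<longleftrightarrow> i \<in> \<sigma>"
    using code_of_witnesses[of d n U] unfolding code by metis
  \<comment> \<open>Only the sets containing a witness limit \<open>e\<close>; sets avoided by it
    are still avoided after shrinking.\<close>
  have "\<forall>\<^sub>F e in at_right 0. \<forall>\<sigma>\<in>C. \<forall>i\<in>\<sigma>. cube d (p \<sigma>) e \<subseteq> U i"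
  proof (intro eventually_ball_finite ballI)
    show "finite C" by (rule simplicial_complexD(3)[OF C])
    fix \<sigma> assume \<sigma>: "\<sigma> \<in> C"
    then have sub: "\<sigma> \<subseteq> {1..n}" using simplicial_complexD(1)[OF C] by blast
    then show "finite \<sigma>" by (rule finite_subset) simp
    fix i assume "i \<in> \<sigma>"
    then show "\<forall>\<^sub>F e in at_right 0. cube d (p \<sigma>) e \<subseteq> U i"
      using \<sigma> sub p opn by (intro eventually_cube_subset) auto
  qed
  then have "\<forall>\<^sub>F e in at_right (0::real). 0 < e \<and> (\<forall>\<sigma>\<in>C. \<forall>i\<in>\<sigma>. cube d (p \<sigma>) e \<subseteq> U i)"
    by (intro eventually_conj eventually_at_right_less)
  then obtain e :: real where e: "0 < e" "\<And>\<sigma> i. \<sigma> \<in> C \<Longrightarrow> i \<in> \<sigma> \<Longrightarrow> cube d (p \<sigma>) e \<subseteq> U i"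
    using eventually_happens'[OF trivial_limit_at_right_real] by (metis (no_types, lifting))
  have "code_of d n (\<lambda>i. erode d e (U i)) = C"
  proof (rule code_of_eqI[OF simplicial_complexD(1)[OF C]])
    fix \<sigma> assume \<sigma>: "\<sigma> \<in> C"
    have "p \<sigma> \<in> erode d e (U i) \<longleftrightarrow> i \<in> \<sigma>" if "i \<in> {1..n}" for i
      using p(1)[OF \<sigma>] p(2)[OF \<sigma> that] e(2)[OF \<sigma>, of i] erode_subset[OF e(1), of d "U i"]
        mem_erode_iff[of "p \<sigma>" d e "U i"] by blast
    then show "\<exists>x\<in>topspace (Euclidean_space d). \<forall>i\<in>{1..n}. x \<in> erode d e (U i) \<longleftrightarrow> i \<in> \<sigma>"
      using p(1)[OF \<sigma>] by blast
  next
    fix x assume "x \<in> topspace (Euclidean_space d)"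
    then show "{i\<in>{1..n}. x \<in> erode d e (U i)} \<in> C"
      \<comment> \<open>The pattern of \<open>x\<close> for the erosions is contained in its pattern
        for \<open>U\<close>.\<close>
      using erode_subset[OF e(1)] by (intro subset_pattern_in_complex[OF C code]) auto
  qed
  then show ?thesis
    using opn closedin_erode convex_fun_erode
    by (intro exI[of _ "\<lambda>i. erode d e (U i)"]) (simp add: closed_convex_realization_def)
qed

lemma open_realization_of_closed:
  assumes C: "is_simplicial_complex n C" and U: "closed_convex_realization d n C U"
  shows "\<exists>V. open_convex_realization d n C V"
proof -
  let ?E = "Euclidean_space d"
  have cls: "closedin ?E (U i)" "convex_fun (U i)" if "i \<in> {1..n}" for i
    using U that by (auto simp: closed_convex_realization_def)
  have code: "code_of d n U = C" using U by (simp add: closed_convex_realization_def)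
  obtain p where p: "\<And>\<sigma>. \<sigma> \<in> C \<Longrightarrow> p \<sigma> \<in> topspace ?E"
    "\<And>\<sigma> i. \<sigma> \<in> C \<Longrightarrow> i \<in> {1..n} \<Longrightarrow> p \<sigma> \<in> U i \<longleftrightarrow> i \<in> \<sigma>"
    using code_of_witnesses[of d n U] unfolding code by metis
  obtain R where R: "p ` C \<subseteq> closed_box d R"
    using finite_subset_closed_box[of "p ` C" d] simplicial_complexD(3)[OF C] p(1) by auto
  \<comment> \<open>Cutting to the box supplies the compactness that unbounded closed sets may lack:
    two disjoint ones can have distance zero. Since the box contains all witnesses, their patterns
    do not change.\<close>
  define A where "A i = U i \<inter> closed_box d R" for i
  have A: "closedin ?E (A i)" "convex_fun (A i)" "A i \<subseteq> closed_box d R" "A i \<subseteq> topspace ?E"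
    if "i \<in> {1..n}" for i
  proof -
    have "closedin ?E (closed_box d R)"
      by (intro compactin_imp_closedin compactin_closed_box)
         (simp add: Hausdorff_Euclidean_space)
    then show "closedin ?E (A i)" using cls[OF that] by (auto simp: A_def)
    then show "A i \<subseteq> topspace ?E" by (rule closedin_subset)
    show "convex_fun (A i)" unfolding A_def
      by (intro convex_fun_Int cls[OF that] convex_fun_closed_box)
  qed (simp add: A_def)
  \<comment> \<open>Thickening can only spoil avoidance at a witness, and each avoided closed set
    has an open complement around it.\<close>
  have "\<forall>\<^sub>F e in at_right 0. \<forall>\<sigma>\<in>C. \<forall>i\<in>{1..n} - \<sigma>. p \<sigma> \<notin> thicken d e (A i)"
  proof (intro eventually_ball_finite ballI)
    show "finite C" by (rule simplicial_complexD(3)[OF C])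
    fix \<sigma> i assume \<sigma>: "\<sigma> \<in> C" "i \<in> {1..n} - \<sigma>"
    then have i: "i \<in> {1..n}" by blast
    have "openin ?E (topspace ?E - A i)" using A(1)[OF i] by (intro openin_diff) auto
    moreover have "p \<sigma> \<in> topspace ?E - A i"
      using p(1)[OF \<sigma>(1)] p(2)[OF \<sigma>(1) i] \<sigma>(2) unfolding A_def by blast
    ultimately have "\<forall>\<^sub>F e in at_right 0. cube d (p \<sigma>) e \<subseteq> topspace ?E - A i"
      by (rule eventually_cube_subset)
    then show "\<forall>\<^sub>F e in at_right 0. p \<sigma> \<notin> thicken d e (A i)"
      by (rule eventually_mono) (use p(1)[OF \<sigma>(1)] mem_thicken_iff[OF A(4)[OF i]] in blast)
  qed auto
  \<comment> \<open>There are finitely many non-codewords \<open>\<tau>\<close>, so one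
    \<open>e\<close> serves them all. Each is nonempty because \<open>{}\<close> is a
    codeword.\<close>
  moreover have "\<forall>\<^sub>F e in at_right 0. \<forall>\<tau>\<in>Pow {1..n} - C. (\<Inter>i\<in>\<tau>. thicken d e (A i)) = {}"
  proof (intro eventually_ball_finite ballI)
    fix \<tau> assume \<tau>: "\<tau> \<in> Pow {1..n} - C"
    then have ne: "\<tau> \<noteq> {}" using simplicial_complexD(2)[OF C] by blast
    have disjoint: "(\<Inter>i\<in>\<tau>. A i) = {}"
    proof (rule ccontr)
      assume "\<not> ?thesis"
      then obtain x where x: "\<And>i. i \<in> \<tau> \<Longrightarrow> x \<in> A i" by blast
      then have "x \<in> topspace ?E" using ne \<tau> A(4) by blast
      then have "\<tau> \<in> C"
        using x \<tau> by (intro subset_pattern_in_complex[OF C code]) (auto simp: A_def)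
      then show False using \<tau> by blast
    qed
    show "\<forall>\<^sub>F e in at_right 0. (\<Inter>i\<in>\<tau>. thicken d e (A i)) = {}"
    proof (rule eventually_thicken_disjoint[OF compactin_closed_box[of d R] ne])
      fix i assume "i \<in> \<tau>"
      then have "i \<in> {1..n}" using \<tau> by blast
      then show "closedin ?E (A i)" "A i \<subseteq> closed_box d R" by (fact A)+
    qed (fact disjoint)
  qed auto
  moreover have "\<forall>\<^sub>F e in at_right (0::real). 0 < e" by (rule eventually_at_right_less)
  ultimately have ev: "\<forall>\<^sub>F e in at_right (0::real). 0 < e
      \<and> (\<forall>\<sigma>\<in>C. \<forall>i\<in>{1..n} - \<sigma>. p \<sigma> \<notin> thicken d e (A i))
      \<and> (\<forall>\<tau>\<in>Pow {1..n} - C. (\<Inter>i\<in>\<tau>. thicken d e (A i)) = {})"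
    by (intro eventually_conj)
  obtain e :: real where e: "0 < e"
    and avoid: "\<forall>\<sigma>\<in>C. \<forall>i\<in>{1..n} - \<sigma>. p \<sigma> \<notin> thicken d e (A i)"
    and disj: "\<forall>\<tau>\<in>Pow {1..n} - C. (\<Inter>i\<in>\<tau>. thicken d e (A i)) = {}"
    using eventually_happens'[OF trivial_limit_at_right_real ev] by blast
  have "code_of d n (\<lambda>i. thicken d e (A i)) = C"
  proof (rule code_of_eqI[OF simplicial_complexD(1)[OF C]])
    fix \<sigma> assume \<sigma>: "\<sigma> \<in> C"
    have "p \<sigma> \<in> thicken d e (A i)" if "i \<in> {1..n}" "i \<in> \<sigma>" for i
    proof -
      have "p \<sigma> \<in> A i" using that p(2)[OF \<sigma> that(1)] R \<sigma> unfolding A_def by blast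
      then show ?thesis using subset_thicken[OF A(4)[OF that(1)] e] by blast
    qed
    then show "\<exists>x\<in>topspace ?E. \<forall>i\<in>{1..n}. x \<in> thicken d e (A i) \<longleftrightarrow> i \<in> \<sigma>"
      using p(1)[OF \<sigma>] avoid \<sigma> by blast
  next
    fix x
    show "{i\<in>{1..n}. x \<in> thicken d e (A i)} \<in> C"
    proof (rule ccontr)
      \<comment> \<open>If the pattern of \<open>x\<close> were a non-codeword, \<open>x\<close>
        would lie in an intersection that \<open>disj\<close> makes empty.\<close>
      let ?\<tau> = "{i\<in>{1..n}. x \<in> thicken d e (A i)}"
      assume "?\<tau> \<notin> C"
      then have "(\<Inter>i\<in>?\<tau>. thicken d e (A i)) = {}" by (intro bspec[OF disj]) blast
      moreover have "x \<in> (\<Inter>i\<in>?\<tau>. thicken d e (A i))" by blast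
      ultimately show False by blast
    qed
  qed
  then show ?thesis
    using A openin_thicken convex_fun_thicken
    by (intro exI[of _ "\<lambda>i. thicken d e (A i)"]) (simp add: open_convex_realization_def)
qed

theorem theorem1p4:
  fixes n :: nat and C :: "nat set set"
  assumes "is_simplicial_complex n C"
  shows "cdim n C = odim n C"
proof -
  \<comment> \<open>Both infima range over the same set of \<open>d\<close>, so the value infinity
    is covered as well.\<close>
  have "(\<exists>U. closed_convex_realization d n C U) \<longleftrightarrow> (\<exists>U. open_convex_realization d n C U)" for d
    using closed_realization_of_open open_realization_of_closed assms by blast
  then show ?thesis by (simp add: cdim_def odim_def)
qed

end
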